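(* The operator $L_w:L^2(\Omega)\to\mathcal D'(L^* )$ is a bijective isometry, so that $\|q\|=\|L_wq\|_{\mathcal D'(L^* )}$ for all $q\in L^2(\Omega)$. In particular, $\|u\|=\|\mathcal E Lu\|_{\mathcal D'(L^* )}$ for all $u\in\mathcal D(L)$.
   Context: $\Omega\subset\mathbb R^d$ is a domain; $L^2(\Omega)$ (real-valued) has norm $\|\cdot\|$ and inner product $\langle\cdot,\cdot\rangle$. $L$ is a linear first-order differential operator, regarded as a closed, densely defined unbounded linear operator in $L^2(\Omega)$ with domain $\mathcal D(L)$ (the functions $u\in L^2(\Omega)$ with $Lu\in L^2(\Omega)$ satisfying given homogeneous boundary conditions). $L^*$ with domain $\mathcal D(L^* )$ is its $L^2(\Omega)$-adjoint. Standing assumptions: (i) there is $c_P^*>0$ with $c_P^*\|w\|\le\|L^*w\|$ for all $w\in\mathcal D(L^* )$; (ii) $L^*(\mathcal D(L^* ))=L^2(\Omega)$. By (i), $\mathcal D(L^* )$ is a Hilbert space with norm $\|w\|_{\mathcal D(L^* )}=\|L^*w\|$. $\mathcal D'(L^* )$ is its dual space, with norm $\|\ell\|_{\mathcal D'(L^* )}=\sup_{0\ne w\in\mathcal D(L^* )}|\ell(w)|/\|L^*w\|$. $L_w:L^2(\Omega)\to\mathcal D'(L^* )$ is defined by $(L_wq)(w)=\langle q,L^*w\rangle$ for $w\in\mathcal D(L^* )$. The embedding $\mathcal E:L^2(\Omega)\to\mathcal D'(L^* )$ is defined by $(\mathcal Eq)(w)=\langle q,w\rangle$ for $w\in\mathcal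 D(L^* )$. *)

theory Defs
  imports "HOL-Analysis.Analysis"
begin

section \<open>Real-valued square-integrable functions modulo null sets\<close>

definition sq_int :: "('a::euclidean_space \<Rightarrow> real) set" where
  "sq_int = {f. f \<in> borel_measurable lebesgue \<and> integrable lebesgue (\<lambda>x. (f x)\<^sup>2)}"

lemma sq_int_mult:
  assumes "f \<in> sq_int" "g \<in> sq_int"
  shows "integrable lebesgue (\<lambda>x. f x * g x)"
proof (rule Bochner_Integration.integrable_bound)
  show "integrable lebesgue (\<lambda>x. (f x)\<^sup>2 + (g x)\<^sup>2)"
    using assms by (auto simp: sq_int_def)
  show "(\<lambda>x. f x * g x) \<in> borel_measurable lebesgue"
    using assms by (auto simp: sq_int_def)
  have "\<bar>f x * g x\<bar> \<le> (f x)\<^sup>2 + (g x)\<^sup>2" for x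
  proof -
    have "2 * \<bar>f x\<bar> * \<bar>g x\<bar> \<le> \<bar>f x\<bar>\<^sup>2 + \<bar>g x\<bar>\<^sup>2"
      by (rule sum_squares_bound)
    moreover have "0 \<le> \<bar>f x\<bar> * \<bar>g x\<bar>" by simp
    ultimately show ?thesis unfolding abs_mult power2_abs by linarith
  qed
  then show "AE x in lebesgue. norm (f x * g x) \<le> norm ((f x)\<^sup>2 + (g x)\<^sup>2)"
    by (intro AE_I2) simp
qed

lemma sq_int_zero: "(\<lambda>x. 0) \<in> sq_int"
  by (simp add: sq_int_def)

lemma sq_int_scale: "f \<in> sq_int \<Longrightarrow> (\<lambda>x. c * f x) \<in> sq_int"
  by (auto simp: sq_int_def power_mult_distrib)

lemma sq_int_add:
  assumes "f \<in> sq_int" "g \<in> sq_int"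
  shows "(\<lambda>x. f x + g x) \<in> sq_int"
proof -
  have "integrable lebesgue (\<lambda>x. (f x)\<^sup>2 + (g x)\<^sup>2 + 2 * (f x * g x))"
    using assms sq_int_mult[OF assms] by (auto simp: sq_int_def)
  then show ?thesis
    using assms by (auto simp: sq_int_def power2_sum mult.assoc)
qed

quotient_type (overloaded) 'a L2 = "'a::euclidean_space \<Rightarrow> real" / partial:
  "\<lambda>f g. f \<in> sq_int \<and> g \<in> sq_int \<and> (AE x in lebesgue. f x = g x)"
  morphisms L2_rep L2_class
proof (rule part_equivpI)
  show "\<exists>f :: 'a \<Rightarrow> real. f \<in> sq_int \<and> f \<in> sq_int \<and> (AE x in lebesgue. f x = f x)"
    using sq_int_zero by blast
qed (auto intro!: sympI transpI elim: AE_mp)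

instantiation L2 :: (euclidean_space) real_vector
begin

lift_definition zero_L2 :: "'a L2" is "\<lambda>x. 0"
  by (simp add: sq_int_zero)

lift_definition plus_L2 :: "'a L2 \<Rightarrow> 'a L2 \<Rightarrow> 'a L2" is "\<lambda>f g x. f x + g x"
  by (auto intro: sq_int_add)

lift_definition scaleR_L2 :: "real \<Rightarrow> 'a L2 \<Rightarrow> 'a L2" is "\<lambda>c f x. c * f x"
  by (auto intro: sq_int_scale)

definition uminus_L2 :: "'a L2 \<Rightarrow> 'a L2" where
  "uminus_L2 u = (-1) *\<^sub>R u"

definition minus_L2 :: "'a L2 \<Rightarrow> 'a L2 \<Rightarrow> 'a L2" where
  "minus_L2 u v = u + (- v)"

instance
proof
  fix u v w :: "'a L2" and r s :: real
  show "u + v + w = u + (v + w)"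
    by transfer (simp add: add.assoc sq_int_add)
  show "u + v = v + u"
    by transfer (simp add: add.commute sq_int_add)
  show "0 + u = u"
    by transfer simp
  show "- u + u = 0"
    unfolding uminus_L2_def by transfer (simp add: sq_int_zero)
  show "u - v = u + - v"
    by (rule minus_L2_def)
  show "r *\<^sub>R (u + v) = r *\<^sub>R u + r *\<^sub>R v"
    by transfer (auto simp: distrib_left intro!: sq_int_add sq_int_scale
        sq_int_add[OF sq_int_scale sq_int_scale])
  show "(r + s) *\<^sub>R u = r *\<^sub>R u + s *\<^sub>R u"
    by transfer (auto simp: distrib_right intro!: sq_int_add sq_int_scale)
  show "r *\<^sub>R s *\<^sub>R u = (r * s) *\<^sub>R u"
    by transfer (simp add: mult.assoc[symmetric] sq_int_scale)
  show "1 *\<^sub>R u = u"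
    by transfer simp
qed

end

instantiation L2 :: (euclidean_space) real_inner
begin

lift_definition inner_L2 :: "'a L2 \<Rightarrow> 'a L2 \<Rightarrow> real"
  is "\<lambda>f g. LINT x|lebesgue. f x * g x"
  by (intro integral_cong_AE) (auto simp: sq_int_def)

definition norm_L2 :: "'a L2 \<Rightarrow> real" where
  "norm_L2 u = sqrt (inner u u)"

definition sgn_L2 :: "'a L2 \<Rightarrow> 'a L2" where
  "sgn_L2 u = u /\<^sub>R norm u"

definition dist_L2 :: "'a L2 \<Rightarrow> 'a L2 \<Rightarrow> real" where
  "dist_L2 u v = norm (u - v)"

definition uniformity_L2 :: "('a L2 \<times> 'a L2) filter" where
  "uniformity_L2 = (INF e\<in>{0<..}. principal {(u, v). dist u v < e})"

definition open_L2 :: "'a L2 set \<Rightarrow> bool" where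
  "open_L2 U \<longleftrightarrow> (\<forall>u\<in>U. eventually (\<lambda>(u', v). u' = u \<longrightarrow> v \<in> U) uniformity)"

instance
proof
  fix u v w :: "'a L2" and r :: real and U :: "'a L2 set"
  show "dist u v = norm (u - v)" by (rule dist_L2_def)
  show "sgn u = u /\<^sub>R norm u" by (rule sgn_L2_def)
  show "uniformity = (INF e\<in>{0<..}. principal {(u, v :: 'a L2). dist u v < e})"
    by (rule uniformity_L2_def)
  show "open U \<longleftrightarrow> (\<forall>u\<in>U. eventually (\<lambda>(u', v). u' = u \<longrightarrow> v \<in> U) uniformity)"
    by (rule open_L2_def)
  show "inner u v = inner v u"
    by transfer (simp add: mult.commute)
  show "inner (u + v) w = inner u w + inner v w"
    by transfer (simp add: distrib_right sq_int_mult)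
  show "inner (r *\<^sub>R u) v = r * inner u v"
    by transfer (simp add: mult.assoc)
  show "0 \<le> inner u u"
    by transfer simp
  show "inner u u = 0 \<longleftrightarrow> u = 0"
  proof transfer
    fix f :: "'a \<Rightarrow> real"
    assume f: "f \<in> sq_int \<and> f \<in> sq_int \<and> (AE x in lebesgue. f x = f x)"
    then have "(LINT x|lebesgue. f x * f x) = 0 \<longleftrightarrow> (AE x in lebesgue. f x * f x = 0)"
      by (intro integral_nonneg_eq_0_iff_AE) (auto intro: sq_int_mult)
    then show "((LINT x|lebesgue. f x * f x) = 0) =
        (f \<in> sq_int \<and> (\<lambda>x. 0) \<in> sq_int \<and> (AE x in lebesgue. f x = 0))"
      using f by (simp add: sq_int_zero)
  qed
  show "norm u = sqrt (inner u u)" by (rule norm_L2_def)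
qed

end

text \<open>\<open>L2_on \<Omega>\<close> is \<open>L\<^sup>2(\<Omega>)\<close>, with functions on \<open>\<Omega>\<close> extended by zero to the whole space;
  the extension preserves inner products and norms.\<close>

definition L2_on :: "'a::euclidean_space set \<Rightarrow> 'a L2 set" where
  "L2_on \<Omega> = {u. AE x in lebesgue. x \<notin> \<Omega> \<longrightarrow> L2_rep u x = 0}"


section \<open>Closed, densely defined operators in \<open>L\<^sup>2(\<Omega>)\<close>\<close>

text \<open>An unbounded operator is a pair of a domain \<open>D\<close> and a map \<open>L\<close>; the values of \<open>L\<close>
  outside \<open>D\<close> are irrelevant.\<close>

definition linear_operator_in ::
    "'a::euclidean_space set \<Rightarrow> 'a L2 set \<Rightarrow> ('a L2 \<Rightarrow> 'a L2) \<Rightarrow> bool" where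
  "linear_operator_in \<Omega> D L \<longleftrightarrow>
     subspace D \<and> D \<subseteq> L2_on \<Omega> \<and> L ` D \<subseteq> L2_on \<Omega> \<and>
     (\<forall>u\<in>D. \<forall>v\<in>D. L (u + v) = L u + L v) \<and> (\<forall>r. \<forall>u\<in>D. L (r *\<^sub>R u) = r *\<^sub>R L u)"

definition densely_defined :: "'a::euclidean_space set \<Rightarrow> 'a L2 set \<Rightarrow> bool" where
  "densely_defined \<Omega> D \<longleftrightarrow> L2_on \<Omega> \<subseteq> closure D"

definition closed_operator :: "'a::euclidean_space L2 set \<Rightarrow> ('a L2 \<Rightarrow> 'a L2) \<Rightarrow> bool" where
  "closed_operator D L \<longleftrightarrow> closed ((\<lambda>u. (u, L u)) ` D)"

definition adj_dom ::
    "'a::euclidean_space set \<Rightarrow> 'a L2 set \<Rightarrow> ('a L2 \<Rightarrow> 'a L2) \<Rightarrow> 'a L2 set" where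
  "adj_dom \<Omega> D L =
     {w \<in> L2_on \<Omega>. \<exists>z\<in>L2_on \<Omega>. \<forall>u\<in>D. inner (L u) w = inner u z}"

definition adj ::
    "'a::euclidean_space set \<Rightarrow> 'a L2 set \<Rightarrow> ('a L2 \<Rightarrow> 'a L2) \<Rightarrow> 'a L2 \<Rightarrow> 'a L2" where
  "adj \<Omega> D L w = (THE z. z \<in> L2_on \<Omega> \<and> (\<forall>u\<in>D. inner (L u) w = inner u z))"


section \<open>First-order differential operators with homogeneous boundary conditions\<close>

text \<open>\<open>F\<close> collects the partial derivatives of \<open>f\<close> of all orders.\<close>

definition smooth :: "('a::euclidean_space \<Rightarrow> real) \<Rightarrow> bool" where
  "smooth f \<longleftrightarrow> (\<exists>F. f \<in> F \<and> (\<forall>g\<in>F. (\<forall>x. g differentiable (at x)) \<and>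
     (\<forall>i\<in>Basis. (\<lambda>x. frechet_derivative g (at x) i) \<in> F)))"

definition test_functions :: "'a::euclidean_space set \<Rightarrow> ('a \<Rightarrow> real) set" where
  "test_functions \<Omega> = {\<phi>. smooth \<phi> \<and> compact (closure {x. \<phi> x \<noteq> 0}) \<and> closure {x. \<phi> x \<noteq> 0} \<subseteq> \<Omega>}"

definition locally_integrable_on ::
    "'a::euclidean_space set \<Rightarrow> ('a \<Rightarrow> 'b::euclidean_space) \<Rightarrow> bool" where
  "locally_integrable_on \<Omega> f \<longleftrightarrow> (\<forall>K. compact K \<and> K \<subseteq> \<Omega> \<longrightarrow> set_integrable lebesgue K f)"

definition weak_partial ::
    "'a::euclidean_space set \<Rightarrow> 'a \<Rightarrow> ('a \<Rightarrow> real) \<Rightarrow> ('a \<Rightarrow> real) \<Rightarrow> bool" where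
  "weak_partial \<Omega> i u g \<longleftrightarrow>
     locally_integrable_on \<Omega> u \<and> locally_integrable_on \<Omega> g \<and>
     (\<forall>\<phi>\<in>test_functions \<Omega>.
        (LINT x:\<Omega>|lebesgue. u x * frechet_derivative \<phi> (at x) i) = - (LINT x:\<Omega>|lebesgue. g x * \<phi> x))"

text \<open>\<open>first_order_eq \<Omega> a b c u f\<close>: the equation
  \<open>div (a u) + b \<bullet> grad u + c u = f\<close> holds in the sense of distributions on \<open>\<Omega>\<close>.
  In the term \<open>b \<bullet> grad u\<close> the derivatives are weak derivatives \<open>g\<close>, needed only in those
  directions in which \<open>b\<close> does not vanish; the term \<open>div (a u)\<close> requires no derivative
  of \<open>u\<close> on its own. An operator \<open>a \<bullet> grad u + c u\<close> with differentiable \<open>a\<close> acting on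
  distributions is \<open>div (a u) + (c - div a) u\<close>.\<close>

definition first_order_eq ::
    "'a::euclidean_space set \<Rightarrow> ('a \<Rightarrow> 'a) \<Rightarrow> ('a \<Rightarrow> 'a) \<Rightarrow> ('a \<Rightarrow> real) \<Rightarrow>
     ('a \<Rightarrow> real) \<Rightarrow> ('a \<Rightarrow> real) \<Rightarrow> bool" where
  "first_order_eq \<Omega> a b c u f \<longleftrightarrow>
     (\<exists>g :: 'a \<Rightarrow> 'a.
        (\<forall>i\<in>Basis. (\<forall>x\<in>\<Omega>. b x \<bullet> i = 0) \<or> weak_partial \<Omega> i u (\<lambda>x. g x \<bullet> i)) \<and>
        locally_integrable_on \<Omega> (\<lambda>x. u x *\<^sub>R a x) \<and>
        locally_integrable_on \<Omega> (\<lambda>x. b x \<bullet> g x + c x * u x) \<and>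
        (\<forall>\<phi>\<in>test_functions \<Omega>.
           (LINT x:\<Omega>|lebesgue. f x * \<phi> x) =
           (LINT x:\<Omega>|lebesgue. - (u x * frechet_derivative \<phi> (at x) (a x))
                              + (b x \<bullet> g x + c x * u x) * \<phi> x)))"

text \<open>The boundary conditions enter only through the functions \<open>u\<close> that satisfy them, \<open>bc u\<close>;
  their homogeneity is the linearity of the resulting domain, see \<open>linear_operator_in\<close>.\<close>

definition first_order_operator ::
    "'a::euclidean_space set \<Rightarrow> ('a \<Rightarrow> 'a) \<Rightarrow> ('a \<Rightarrow> 'a) \<Rightarrow> ('a \<Rightarrow> real) \<Rightarrow>
     ('a L2 \<Rightarrow> bool) \<Rightarrow> 'a L2 set \<Rightarrow> ('a L2 \<Rightarrow> 'a L2) \<Rightarrow> bool" where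
  "first_order_operator \<Omega> a b c bc D L \<longleftrightarrow>
     D = {u \<in> L2_on \<Omega>. (\<exists>f\<in>L2_on \<Omega>. first_order_eq \<Omega> a b c (L2_rep u) (L2_rep f)) \<and> bc u} \<and>
     (\<forall>u\<in>D. L u \<in> L2_on \<Omega> \<and> first_order_eq \<Omega> a b c (L2_rep u) (L2_rep (L u)))"


section \<open>The dual space of \<open>\<D>(L\<^sup>*)\<close>\<close>

text \<open>In this section \<open>W\<close> and \<open>T\<close> stand for \<open>\<D>(L\<^sup>*)\<close> and \<open>L\<^sup>*\<close>, so that \<open>W\<close> carries
  the norm \<open>norm (T w)\<close>. Functionals on \<open>W\<close> are total functions that are \<open>undefined\<close>
  outside \<open>W\<close>, so that equality of functionals means equality on \<open>W\<close>.\<close>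

definition dual_space ::
    "'a::euclidean_space L2 set \<Rightarrow> ('a L2 \<Rightarrow> 'a L2) \<Rightarrow> ('a L2 \<Rightarrow> real) set" where
  "dual_space W T =
     {l \<in> extensional W.
        (\<forall>v\<in>W. \<forall>w\<in>W. l (v + w) = l v + l w) \<and> (\<forall>r. \<forall>w\<in>W. l (r *\<^sub>R w) = r * l w) \<and>
        (\<exists>C. \<forall>w\<in>W. \<bar>l w\<bar> \<le> C * norm (T w))}"

definition dual_norm ::
    "'a::euclidean_space L2 set \<Rightarrow> ('a L2 \<Rightarrow> 'a L2) \<Rightarrow> ('a L2 \<Rightarrow> real) \<Rightarrow> real" where
  "dual_norm W T l = (SUP w\<in>W - {0}. \<bar>l w\<bar> / norm (T w))"

definition weak_op ::
    "'a::euclidean_space L2 set \<Rightarrow> ('a L2 \<Rightarrow> 'a L2) \<Rightarrow> 'a L2 \<Rightarrow> 'a L2 \<Rightarrow> real" where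
  "weak_op W T q = (\<lambda>w\<in>W. inner q (T w))"

definition dual_embedding :: "'a::euclidean_space L2 set \<Rightarrow> 'a L2 \<Rightarrow> 'a L2 \<Rightarrow> real" where
  "dual_embedding W q = (\<lambda>w\<in>W. inner q w)"

end

theory Submission
  imports Defs
begin

text \<open>
  Since \<open>L\<^sup>*\<close> is injective with range \<open>L\<^sup>2(\<Omega>)\<close>, it is an isometric isomorphism from \<open>\<D>(L\<^sup>*)\<close> with
  the norm \<open>norm (L\<^sup>* w)\<close> onto \<open>L\<^sup>2(\<Omega>)\<close>, and \<open>L\<^sub>w\<close> is the Riesz map of \<open>L\<^sup>2(\<Omega>)\<close> followed by the
  transpose of this isomorphism. The functionals \<open>\<E> L u\<close> and \<open>L\<^sub>w u\<close> agree by the definition of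
  the adjoint.
\<close>

section \<open>Riesz representation on a complete subspace\<close>

text \<open>First-order optimality condition: for small \<open>t\<close> the linear term outweighs
  the quadratic one, so a nonzero \<open>a\<close> would make the expression negative for some
  \<open>t\<close> of the opposite sign.\<close>

lemma eq_zero_if_linear_term_dominated:
  fixes a b :: real
  assumes "\<And>t. 0 \<le> t * a + t\<^sup>2 * b"
  shows "a = 0"
proof (rule ccontr)
  assume a: "a \<noteq> 0"
  \<comment> \<open>This \<open>s\<close> is positive and exceeds \<open>b\<close> whatever the sign
    of \<open>b\<close>, so at \<open>t = - a / s\<close> the linear term wins.\<close>
  define s where "s = \<bar>b\<bar> + 1"
  have s: "s > 0" "b < s" by (auto simp: s_def)
  have "(- a / s) * a + (- a / s)\<^sup>2 * b = a\<^sup>2 / s * (b / s - 1)"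
    using s by (simp add: field_simps power2_eq_square)
  also have "\<dots> < 0"
    using a s by (intro mult_pos_neg) (auto simp: field_simps)
  finally show False
    using assms[of "- a / s"] by simp
qed

lemma Riesz_representation_complete_subspace:
  fixes S :: "'b::real_inner set" and m :: "'b \<Rightarrow> real"
  assumes S: "subspace S" and "complete S"
    and add: "\<And>x y. x \<in> S \<Longrightarrow> y \<in> S \<Longrightarrow> m (x + y) = m x + m y"
    and scale: "\<And>r x. x \<in> S \<Longrightarrow> m (r *\<^sub>R x) = r * m x"
    and bound: "\<And>x. x \<in> S \<Longrightarrow> \<bar>m x\<bar> \<le> C * norm x"
  shows "\<exists>q\<in>S. \<forall>x\<in>S. m x = inner q x"
proof -
  text \<open>The representing vector minimises the Dirichlet functional \<open>J\<close>.\<close>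
  define J where "J x = inner x x - 2 * m x" for x
  define d where "d = Inf (J ` S)"
  have diff: "m (x - y) = m x - m y" if "x \<in> S" "y \<in> S" for x y
    using add[of x "(-1) *\<^sub>R y"] scale[of y "-1"] that S by (simp add: subspace_neg)
  \<comment> \<open>Since \<open>m x\<close> is at most \<open>C * norm x\<close>,
    \<open>J x\<close> is at least \<open>(norm x - C)^2 - C^2\<close>.\<close>
  have "- C\<^sup>2 \<le> J x" if "x \<in> S" for x
  proof -
    have "0 \<le> (norm x - C)\<^sup>2" by simp
    then have "2 * (C * norm x) \<le> (norm x)\<^sup>2 + C\<^sup>2"
      by (simp add: power2_diff algebra_simps)
    then show ?thesis
      using bound[OF that] by (simp add: J_def power2_norm_eq_inner)
  qed
  then have bdd: "bdd_below (J ` S)" by (intro bdd_belowI2)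
  have d_le: "d \<le> J x" if "x \<in> S" for x
    unfolding d_def using bdd that by (rule cINF_lower)
  have "\<exists>x\<in>S. J x < d + 1 / real (Suc n)" for n
  proof (rule ccontr)
    assume "\<not> ?thesis"
    then have "d + 1 / real (Suc n) \<le> d"
      unfolding d_def using subspace_0[OF S] by (intro cINF_greatest) (auto simp: d_def not_less)
    then show False by simp
  qed
  then obtain z where z: "\<And>n. z n \<in> S" "\<And>n. J (z n) < d + 1 / real (Suc n)" by metis
  \<comment> \<open>The linear parts of \<open>J x + J y - 2 * J ?w\<close> cancel at the midpoint
    \<open>?w\<close>, and the parallelogram law evaluates the rest. As \<open>J ?w\<close> is at
    least \<open>d\<close>, points with nearly minimal \<open>J\<close> are close to each
    other.\<close>
  have parallelogram: "(norm (x - y))\<^sup>2 / 2 \<le> J x + J y - 2 * d" if "x \<in> S" "y \<in> S" for x y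
  proof -
    let ?w = "(1/2) *\<^sub>R (x + y)"
    have w: "?w \<in> S" using that S by (simp add: subspace_add subspace_scale)
    have "m ?w = (m x + m y) / 2"
      using that S by (simp add: scale add subspace_add)
    moreover have "inner ?w ?w = (inner x x + 2 * inner x y + inner y y) / 4"
      by (simp add: inner_add_left inner_add_right inner_commute[of y x] add_divide_distrib)
    moreover have "(norm (x - y))\<^sup>2 = inner x x - 2 * inner x y + inner y y"
      by (simp add: power2_norm_eq_inner inner_diff_left inner_diff_right inner_commute[of y x])
    ultimately have "J x + J y - 2 * J ?w = (norm (x - y))\<^sup>2 / 2"
      unfolding J_def by argo
    then show ?thesis using d_le[OF w] by simp
  qed
  have "Cauchy z"
  proof (rule metric_CauchyI)
    fix e :: real assume e: "0 < e"
    \<comment> \<open>Two values of \<open>J\<close> within \<open>e^2 / 4\<close> of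
      \<open>d\<close> bound half the squared distance by \<open>e^2 / 2\<close>, hence the distance
      by \<open>e\<close>.\<close>
    then have "0 < e\<^sup>2 / 4" by simp
    then obtain N where "1 / real (Suc N) < e\<^sup>2 / 4" using nat_approx_posE by blast
    moreover have "1 / real (Suc n) \<le> 1 / real (Suc N)" if "n \<ge> N" for n
      using that by (simp add: field_simps)
    ultimately have *: "J (z n) < d + e\<^sup>2 / 4" if "n \<ge> N" for n
      using z(2)[of n] that by (meson add_strict_left_mono le_less_trans less_trans)
    have "dist (z m) (z n) < e" if "m \<ge> N" "n \<ge> N" for m n
    proof -
      have "J (z m) < d + e\<^sup>2 / 4" "J (z n) < d + e\<^sup>2 / 4" using * that by auto
      then have "(norm (z m - z n))\<^sup>2 < e\<^sup>2"
        using parallelogram[OF z(1)[of m] z(1)[of n]] by linarith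
      then show ?thesis
        unfolding dist_norm using e by (auto dest: power2_less_imp_less)
    qed
    then show "\<exists>N. \<forall>m\<ge>N. \<forall>n\<ge>N. dist (z m) (z n) < e"
      by blast
  qed
  then obtain q where q: "q \<in> S" "z \<longlonglongrightarrow> q"
    using \<open>complete S\<close> z(1) unfolding complete_def by blast
  \<comment> \<open>Continuity of \<open>m\<close> comes from applying the bound to differences; it
    lets \<open>J\<close> pass to the limit, so that \<open>q\<close> attains the infimum.\<close>
  have m_lim: "(\<lambda>n. m (z n)) \<longlonglongrightarrow> m q"
  proof (rule Lim_null[THEN iffD2], rule Lim_null_comparison)
    show "\<forall>\<^sub>F n in sequentially. norm (m (z n) - m q) \<le> C * norm (z n - q)"
      using bound diff z q S by (intro always_eventually allI) (metis real_norm_def subspace_diff)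
    show "(\<lambda>n. C * norm (z n - q)) \<longlonglongrightarrow> 0"
      using q(2) by (auto intro!: tendsto_eq_intros)
  qed
  have "(\<lambda>n. J (z n)) \<longlonglongrightarrow> J q"
    unfolding J_def by (intro tendsto_intros q m_lim)
  moreover have "(\<lambda>n. d + 1 / real (Suc n)) \<longlonglongrightarrow> d"
    using tendsto_add[OF tendsto_const LIMSEQ_inverse_real_of_nat] by (simp add: inverse_eq_divide)
  ultimately have Jq: "J q \<le> d"
    using z(2) by (intro LIMSEQ_le) (auto intro: less_imp_le)
  have "m x = inner q x" if x: "x \<in> S" for x
  proof -
    \<comment> \<open>The right-hand side is \<open>J (q + t *\<^sub>R x) - J q\<close>, expanded in
      powers of \<open>t\<close>.\<close>
    have "0 \<le> t * (2 * (inner q x - m x)) + t\<^sup>2 * inner x x" for t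
    proof -
      have "J q \<le> J (q + t *\<^sub>R x)"
        using Jq d_le[of "q + t *\<^sub>R x"] q x S by (simp add: subspace_add subspace_scale)
      then show ?thesis
        using x q S by (simp add: J_def add scale subspace_scale inner_add_left inner_add_right
            inner_commute algebra_simps power2_eq_square)
    qed
    from eq_zero_if_linear_term_dominated[OF this] show ?thesis by simp
  qed
  with q show ?thesis by blast
qed

section \<open>The space \<open>L2_on\<close>: completeness, linearity, nontriviality\<close>

lemma L2_rep_sq_int: "L2_rep u \<in> sq_int"
  using Quotient3_rep_reflp[OF Quotient3_L2] by blast

lemma L2_rep_measurable [measurable]: "L2_rep u \<in> borel_measurable lebesgue"
  using L2_rep_sq_int unfolding sq_int_def by blast

text \<open>\<open>L2_rep\<close> picks some member of the class, not necessarily \<open>f\<close>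
  itself; pointwise statements about representatives therefore hold only up to null sets.\<close>

lemma L2_rep_L2_class:
  assumes "f \<in> sq_int"
  shows "AE x in lebesgue. L2_rep (L2_class f) x = f x"
  using rep_abs_rsp_left[OF Quotient3_L2, of f f] assms by auto

lemma L2_rep_zero: "AE x in lebesgue. L2_rep 0 x = 0"
  unfolding zero_L2_def by (rule L2_rep_L2_class) (rule sq_int_zero)

lemma L2_rep_add: "AE x in lebesgue. L2_rep (u + v) x = L2_rep u x + L2_rep v x"
  unfolding plus_L2_def by (auto intro!: L2_rep_L2_class sq_int_add L2_rep_sq_int)

lemma L2_rep_scaleR: "AE x in lebesgue. L2_rep (c *\<^sub>R u) x = c * L2_rep u x"
  unfolding scaleR_L2_def by (auto intro!: L2_rep_L2_class sq_int_scale L2_rep_sq_int)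

lemma L2_rep_diff: "AE x in lebesgue. L2_rep (u - v) x = L2_rep u x - L2_rep v x"
  using L2_rep_add[of u "(-1) *\<^sub>R v"] L2_rep_scaleR[of "-1" v] by eventually_elim simp

text \<open>Norms as nonnegative integrals make summation under the integral and Fatou's lemma
  available before integrability of the limit is known.\<close>

lemma norm_L2_eq_nn_integral:
  "(\<integral>\<^sup>+x. ennreal ((L2_rep u x)\<^sup>2) \<partial>lebesgue) = ennreal ((norm u)\<^sup>2)"
proof -
  have "(\<integral>\<^sup>+x. ennreal ((L2_rep u x)\<^sup>2) \<partial>lebesgue) = ennreal (LINT x|lebesgue. (L2_rep u x)\<^sup>2)"
    using L2_rep_sq_int[of u] by (intro nn_integral_eq_integral) (auto simp: sq_int_def)
  also have "(LINT x|lebesgue. (L2_rep u x)\<^sup>2) = inner u u"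
    by (simp add: inner_L2_def power2_eq_square)
  finally show ?thesis by (simp add: power2_norm_eq_inner)
qed

lemma norm_L2_diff_eq_nn_integral:
  "(\<integral>\<^sup>+x. ennreal ((L2_rep u x - L2_rep v x)\<^sup>2) \<partial>lebesgue) = ennreal ((norm (u - v))\<^sup>2)"
  unfolding norm_L2_eq_nn_integral[symmetric]
  using L2_rep_diff[of u v] by (intro nn_integral_cong_AE) (auto elim: AE_mp)

lemma sq_int_iff_nn_integral:
  "f \<in> sq_int \<longleftrightarrow> f \<in> borel_measurable lebesgue \<and> (\<integral>\<^sup>+x. ennreal ((f x)\<^sup>2) \<partial>lebesgue) < \<infinity>"
  by (auto simp: sq_int_def integrable_iff_bounded)

lemma fast_Cauchy_subsequence:
  fixes X :: "nat \<Rightarrow> 'b::metric_space"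
  assumes "Cauchy X"
  shows "\<exists>r. strict_mono r \<and> (\<forall>n. dist (X (r (Suc n))) (X (r n)) < (1/2) ^ n)"
proof -
  have "\<exists>N. \<forall>i\<ge>N. \<forall>j\<ge>N. dist (X i) (X j) < (1/2) ^ n" for n :: nat
    using assms by (intro metric_CauchyD) auto
  then obtain N where N: "\<And>n i j. i \<ge> N n \<Longrightarrow> j \<ge> N n \<Longrightarrow> dist (X i) (X j) < (1/2) ^ n"
    by metis
  \<comment> \<open>Summing the \<open>Suc (N i)\<close> makes \<open>r\<close> strictly increasing
    and keeps \<open>r n\<close> above \<open>N n\<close>.\<close>
  define r where "r n = (\<Sum>i\<le>n. Suc (N i))" for n
  have "strict_mono r" by (auto simp: strict_mono_Suc_iff r_def)
  moreover have "N n \<le> r n" for n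
    using member_le_sum[of n "{..n}" "\<lambda>i. Suc (N i)"] by (simp add: r_def)
  ultimately show ?thesis
    by (intro exI[of _ r]) (auto intro!: N intro: order_trans[OF _ less_imp_le] simp: strict_mono_Suc_iff)
qed

text \<open>The squared increments weighted by \<open>2 ^ n\<close> have integrals at most
  \<open>(1/2) ^ n\<close>, so their sum is finite a.e. An inequality of arithmetic-geometric type
  then turns this into absolute summability of the increments, and the sequence telescopes.\<close>

lemma AE_convergent_of_fast_Cauchy:
  fixes Y :: "nat \<Rightarrow> 'a::euclidean_space L2"
  assumes "\<And>n. dist (Y (Suc n)) (Y n) < (1/2) ^ n"
  shows "AE x in lebesgue. convergent (\<lambda>n. L2_rep (Y n) x)"
proof -
  let ?d = "\<lambda>n x. L2_rep (Y (Suc n)) x - L2_rep (Y n) x"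
  have "(\<integral>\<^sup>+x. (\<Sum>n. ennreal (2 ^ n * (?d n x)\<^sup>2)) \<partial>lebesgue)
      = (\<Sum>n. \<integral>\<^sup>+x. ennreal (2 ^ n * (?d n x)\<^sup>2) \<partial>lebesgue)"
    by (intro nn_integral_suminf) simp
  also have "\<dots> \<le> (\<Sum>n. ennreal ((1/2) ^ n))"
  proof (rule suminf_le)
    fix n
    have "(norm (Y (Suc n) - Y n))\<^sup>2 \<le> ((1/2) ^ n)\<^sup>2"
      using assms[of n] by (intro power_mono) (auto simp: dist_norm)
    then have "2 ^ n * (norm (Y (Suc n) - Y n))\<^sup>2 \<le> 2 ^ n * ((1/2) ^ n)\<^sup>2"
      by (intro mult_left_mono) auto
    also have "\<dots> = (1/2) ^ n"
      by (simp add: power2_eq_square power_divide)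
    finally show "(\<integral>\<^sup>+x. ennreal (2 ^ n * (?d n x)\<^sup>2) \<partial>lebesgue) \<le> ennreal ((1/2) ^ n)"
      by (simp add: ennreal_mult nn_integral_cmult norm_L2_diff_eq_nn_integral)
         (simp add: ennreal_mult[symmetric] ennreal_leI)
  qed auto
  also have "\<dots> = ennreal (\<Sum>n. (1/2) ^ n)"
    by (intro suminf_ennreal2) (auto simp: summable_geometric)
  finally have "(\<integral>\<^sup>+x. (\<Sum>n. ennreal (2 ^ n * (?d n x)\<^sup>2)) \<partial>lebesgue) \<noteq> \<infinity>"
    by (auto simp: top_unique)
  then have "AE x in lebesgue. (\<Sum>n. ennreal (2 ^ n * (?d n x)\<^sup>2)) \<noteq> \<infinity>"
    by (intro nn_integral_PInf_AE) auto
  then show ?thesis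
  proof eventually_elim
    fix x assume "(\<Sum>n. ennreal (2 ^ n * (?d n x)\<^sup>2)) \<noteq> \<infinity>"
    then have "summable (\<lambda>n. 2 ^ n * (?d n x)\<^sup>2)"
      by (intro summable_suminf_not_top) auto
    then have "summable (\<lambda>n. 2 ^ n * (?d n x)\<^sup>2 + (1/2) ^ n)"
      by (intro summable_add) (auto simp: summable_geometric)
    moreover have "norm (?d n x) \<le> 2 ^ n * (?d n x)\<^sup>2 + (1/2) ^ n" for n
    proof -
      \<comment> \<open>Divide the square of \<open>s * \<bar>t\<bar> - 1\<close> by
        \<open>s\<close>. With \<open>s = 2 ^ n\<close> the remainder \<open>1 / s\<close> is itself
        summable.\<close>
      have "\<bar>t\<bar> \<le> s * t\<^sup>2 + 1 / s" if "s > 0" for s t :: real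
      proof -
        have "0 \<le> (s * \<bar>t\<bar> - 1)\<^sup>2 / s" using that by simp
        also have "\<dots> = s * t\<^sup>2 + 1 / s - 2 * \<bar>t\<bar>"
          using that by (simp add: power2_diff power_mult_distrib field_simps power2_eq_square)
        finally show ?thesis by linarith
      qed
      from this[of "2 ^ n"] show ?thesis by (simp add: power_divide)
    qed
    ultimately have "summable (\<lambda>n. ?d n x)"
      by (rule summable_comparison_test'[of _ 0])
    then have "convergent (\<lambda>n. L2_rep (Y 0) x + (\<Sum>i<n. ?d i x))"
      by (intro convergent_add convergent_const) (simp add: summable_iff_convergent)
    then show "convergent (\<lambda>n. L2_rep (Y n) x)"
      by (subst (asm) sum_lessThan_telescope) simp
  qed
qed

text \<open>Riesz-Fischer: the a.e. limit of a fast subsequence is the candidate, and Fatou's lemma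
  makes it the norm limit of the whole sequence. The a.e. convergence is kept in the conclusion
  because membership in \<open>L2_on\<close> is a pointwise condition.\<close>

lemma Cauchy_L2_convergent:
  fixes X :: "nat \<Rightarrow> 'a::euclidean_space L2"
  assumes X: "Cauchy X"
  shows "\<exists>u r. X \<longlonglongrightarrow> u \<and> (AE x in lebesgue. (\<lambda>n. L2_rep (X (r n)) x) \<longlonglongrightarrow> L2_rep u x)"
proof -
  obtain r where r: "strict_mono r" "\<And>n. dist (X (r (Suc n))) (X (r n)) < (1/2) ^ n"
    using fast_Cauchy_subsequence[OF X] by blast
  \<comment> \<open>Where the subsequence diverges, \<open>lim\<close> takes a default value; these
    points form a null set.\<close>
  define f where "f x = lim (\<lambda>n. L2_rep (X (r n)) x)" for x
  have f_meas [measurable]: "f \<in> borel_measurable lebesgue"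
    unfolding f_def by measurable
  have lim: "AE x in lebesgue. (\<lambda>n. L2_rep (X (r n)) x) \<longlonglongrightarrow> f x"
    using AE_convergent_of_fast_Cauchy[of "X \<circ> r"] r(2)
    by (auto simp: f_def convergent_LIMSEQ_iff)
  \<comment> \<open>Let the first index of the Cauchy estimate run to infinity along
    \<open>r\<close>. With \<open>e = 1\<close> this yields square integrability of
    \<open>f\<close>, with arbitrarily small \<open>e\<close> convergence in norm.\<close>
  have fatou: "(\<integral>\<^sup>+x. ennreal ((f x - L2_rep (X n) x)\<^sup>2) \<partial>lebesgue) \<le> ennreal (e\<^sup>2)"
    if e: "\<And>i. i \<ge> N \<Longrightarrow> dist (X i) (X n) < e" for n N e
  proof -
    have "(\<integral>\<^sup>+x. ennreal ((f x - L2_rep (X n) x)\<^sup>2) \<partial>lebesgue)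
        = (\<integral>\<^sup>+x. liminf (\<lambda>i. ennreal ((L2_rep (X (r i)) x - L2_rep (X n) x)\<^sup>2)) \<partial>lebesgue)"
    proof (rule nn_integral_cong_AE, use lim in eventually_elim)
      fix x assume "(\<lambda>i. L2_rep (X (r i)) x) \<longlonglongrightarrow> f x"
      then have "(\<lambda>i. ennreal ((L2_rep (X (r i)) x - L2_rep (X n) x)\<^sup>2))
          \<longlonglongrightarrow> ennreal ((f x - L2_rep (X n) x)\<^sup>2)"
        by (intro tendsto_ennrealI tendsto_intros)
      then show "ennreal ((f x - L2_rep (X n) x)\<^sup>2)
          = liminf (\<lambda>i. ennreal ((L2_rep (X (r i)) x - L2_rep (X n) x)\<^sup>2))"
        by (intro lim_imp_Liminf[symmetric] trivial_limit_sequentially)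
    qed
    also have "\<dots> \<le> liminf (\<lambda>i. \<integral>\<^sup>+x. ennreal ((L2_rep (X (r i)) x - L2_rep (X n) x)\<^sup>2) \<partial>lebesgue)"
      by (intro nn_integral_liminf) simp
    also have "\<dots> \<le> liminf (\<lambda>i. ennreal (e\<^sup>2))"
    proof (rule Liminf_mono, rule eventually_sequentiallyI)
      fix i assume "N \<le> i"
      then have "N \<le> r i" using seq_suble[OF r(1)] order_trans by blast
      then have "(norm (X (r i) - X n))\<^sup>2 \<le> e\<^sup>2"
        using e[of "r i"] by (intro power_mono) (auto simp: dist_norm)
      then show "(\<integral>\<^sup>+x. ennreal ((L2_rep (X (r i)) x - L2_rep (X n) x)\<^sup>2) \<partial>lebesgue) \<le> ennreal (e\<^sup>2)"
        by (simp add: norm_L2_diff_eq_nn_integral ennreal_leI)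
    qed
    finally show ?thesis by (simp add: Liminf_const)
  qed
  obtain N where "\<And>i. i \<ge> N \<Longrightarrow> dist (X i) (X N) < 1"
    using metric_CauchyD[OF X zero_less_one] by auto
  from fatou[of N N 1, OF this] have "(\<lambda>x. f x - L2_rep (X N) x) \<in> sq_int"
    unfolding sq_int_iff_nn_integral by (auto intro: le_less_trans)
  from sq_int_add[OF this L2_rep_sq_int[of "X N"]] have f: "f \<in> sq_int" by simp
  define u where "u = L2_class f"
  have u: "AE x in lebesgue. L2_rep u x = f x"
    unfolding u_def by (rule L2_rep_L2_class[OF f])
  have "X \<longlonglongrightarrow> u"
  proof (rule metric_LIMSEQ_I)
    fix e :: real assume e: "0 < e"
    \<comment> \<open>Half of \<open>e\<close>, because the strict inequality is lost in the
      limit.\<close>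
    obtain N where N: "\<And>i n. i \<ge> N \<Longrightarrow> n \<ge> N \<Longrightarrow> dist (X i) (X n) < e / 2"
      using metric_CauchyD[OF X, of "e / 2"] e by auto
    have "dist (X n) u < e" if "n \<ge> N" for n
    proof -
      have "ennreal ((norm (u - X n))\<^sup>2) = (\<integral>\<^sup>+x. ennreal ((f x - L2_rep (X n) x)\<^sup>2) \<partial>lebesgue)"
        unfolding norm_L2_diff_eq_nn_integral[symmetric]
        using u by (intro nn_integral_cong_AE) (auto elim: AE_mp)
      also have "\<dots> \<le> ennreal ((e / 2)\<^sup>2)"
        using N that by (intro fatou) auto
      finally have "norm (u - X n) \<le> e / 2"
        using e by (simp del: power_divide add: power_mono_iff)
      then show ?thesis using e by (simp add: dist_norm norm_minus_commute)
    qed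
    then show "\<exists>N. \<forall>n\<ge>N. dist (X n) u < e" by blast
  qed
  moreover have "AE x in lebesgue. (\<lambda>n. L2_rep (X (r n)) x) \<longlonglongrightarrow> L2_rep u x"
    using lim u by eventually_elim simp
  ultimately show ?thesis by blast
qed

text \<open>The exceptional null sets of the countably many \<open>X n\<close> are merged into one;
  off it and off the null set where the subsequence fails to converge, the value zero outside
  \<open>\<Omega>\<close> passes to the limit.\<close>

lemma complete_L2_on: "complete (L2_on \<Omega>)"
  unfolding complete_def
proof (intro allI impI, elim conjE)
  fix X :: "nat \<Rightarrow> 'a L2" assume X: "\<forall>n. X n \<in> L2_on \<Omega>" "Cauchy X"
  obtain u r where u: "X \<longlonglongrightarrow> u"
    and lim: "AE x in lebesgue. (\<lambda>n. L2_rep (X (r n)) x) \<longlonglongrightarrow> L2_rep u x"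
    using Cauchy_L2_convergent[OF X(2)] by blast
  have "AE x in lebesgue. \<forall>n. x \<notin> \<Omega> \<longrightarrow> L2_rep (X n) x = 0"
    using X(1) by (subst AE_all_countable) (auto simp: L2_on_def)
  with lim have "AE x in lebesgue. x \<notin> \<Omega> \<longrightarrow> L2_rep u x = 0"
    by eventually_elim (auto intro: LIMSEQ_unique)
  with u show "\<exists>l\<in>L2_on \<Omega>. X \<longlonglongrightarrow> l" by (auto simp: L2_on_def)
qed

lemma subspace_L2_on: "subspace (L2_on \<Omega>)"
proof (rule subspaceI)
  show "0 \<in> L2_on \<Omega>"
    using L2_rep_zero by (auto simp: L2_on_def elim: AE_mp)
  show "u + v \<in> L2_on \<Omega>" if "u \<in> L2_on \<Omega>" "v \<in> L2_on \<Omega>" for u v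
    using that L2_rep_add[of u v] unfolding L2_on_def mem_Collect_eq
    by eventually_elim auto
  show "c *\<^sub>R u \<in> L2_on \<Omega>" if "u \<in> L2_on \<Omega>" for c u
    using that L2_rep_scaleR[of c u] unfolding L2_on_def mem_Collect_eq
    by eventually_elim auto
qed

text \<open>Ensures that the supremum in \<open>dual_norm\<close> ranges over a nonempty set. The
  witness is the indicator of a ball inside \<open>\<Omega>\<close>, which is not a null
  set.\<close>

lemma L2_on_nontrivial:
  fixes \<Omega> :: "'a::euclidean_space set"
  assumes "open \<Omega>" "\<Omega> \<noteq> {}"
  shows "\<exists>u\<in>L2_on \<Omega>. u \<noteq> 0"
proof -
  obtain y e where e: "e > 0" "ball y e \<subseteq> \<Omega>"
    using assms open_contains_ball by blast
  let ?f = "indicat_real (ball y e)"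
  have "(\<lambda>x. (?f x)\<^sup>2) = ?f" by (auto simp: indicator_def)
  then have f: "?f \<in> sq_int"
    using fmeasurableD2[OF lmeasurable_ball, of y e]
    by (auto simp: sq_int_def less_top intro!: integrable_real_indicator borel_measurable_indicator)
  have eq: "AE x in lebesgue. L2_rep (L2_class ?f) x = ?f x"
    by (rule L2_rep_L2_class[OF f])
  then have "AE x in lebesgue. x \<notin> \<Omega> \<longrightarrow> L2_rep (L2_class ?f) x = 0"
    by eventually_elim (use e in \<open>auto simp: indicator_def\<close>)
  moreover have "L2_class ?f \<noteq> 0"
  proof
    assume "L2_class ?f = 0"
    then have "AE x in lebesgue. x \<notin> ball y e"
      using eq L2_rep_zero by (auto elim!: AE_mp simp: indicator_def split: if_splits)
    then have "ball y e \<in> null_sets lebesgue"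
      by (subst AE_iff_null_sets) auto
    then show False
      using open_not_negligible[of "ball y e"] e
      by (simp add: negligible_iff_null_sets)
  qed
  ultimately show ?thesis by (auto simp: L2_on_def)
qed

section \<open>The adjoint of a densely defined operator\<close>

text \<open>Density makes the description in \<open>adj\<close> definite: the difference of two
  candidates is orthogonal to \<open>D\<close>, hence to \<open>closure D\<close>, which contains
  that difference.\<close>

lemma adj_eqI:
  assumes "densely_defined \<Omega> D" "z \<in> L2_on \<Omega>" "\<And>u. u \<in> D \<Longrightarrow> inner (L u) w = inner u z"
  shows "adj \<Omega> D L w = z"
  unfolding adj_def
proof (rule the_equality)
  show "z \<in> L2_on \<Omega> \<and> (\<forall>u\<in>D. inner (L u) w = inner u z)" using assms by blast
  fix y assume y: "y \<in> L2_on \<Omega> \<and> (\<forall>u\<in>D. inner (L u) w = inner u y)"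
  have "closed {u. inner u (y - z) = 0}"
    by (intro closed_Collect_eq continuous_intros)
  moreover have "D \<subseteq> {u. inner u (y - z) = 0}"
    using assms y by (auto simp: inner_diff_right)
  ultimately have "closure D \<subseteq> {u. inner u (y - z) = 0}"
    by (rule closure_minimal[rotated])
  moreover have "y - z \<in> closure D"
    using assms y subspace_diff[OF subspace_L2_on] unfolding densely_defined_def by blast
  ultimately show "y = z" by auto
qed

lemma adj_adj_dom:
  assumes "densely_defined \<Omega> D" "w \<in> adj_dom \<Omega> D L"
  shows "adj \<Omega> D L w \<in> L2_on \<Omega>" "u \<in> D \<Longrightarrow> inner (L u) w = inner u (adj \<Omega> D L w)"
proof -
  obtain z where z: "z \<in> L2_on \<Omega>" "\<And>u. u \<in> D \<Longrightarrow> inner (L u) w = inner u z"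
    using assms(2) unfolding adj_dom_def by blast
  then have "adj \<Omega> D L w = z" by (rule adj_eqI[OF assms(1)])
  with z show "adj \<Omega> D L w \<in> L2_on \<Omega>" "u \<in> D \<Longrightarrow> inner (L u) w = inner u (adj \<Omega> D L w)"
    by auto
qed

lemma adj_dom_adj_add:
  assumes "densely_defined \<Omega> D" "v \<in> adj_dom \<Omega> D L" "w \<in> adj_dom \<Omega> D L"
  shows "v + w \<in> adj_dom \<Omega> D L \<and> adj \<Omega> D L (v + w) = adj \<Omega> D L v + adj \<Omega> D L w"
proof -
  have "adj \<Omega> D L v + adj \<Omega> D L w \<in> L2_on \<Omega>" "v + w \<in> L2_on \<Omega>"
    using assms adj_adj_dom(1)[OF assms(1)]
    by (auto simp: adj_dom_def intro!: subspace_add[OF subspace_L2_on])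
  moreover have "inner (L u) (v + w) = inner u (adj \<Omega> D L v + adj \<Omega> D L w)" if "u \<in> D" for u
    using that assms by (simp add: inner_add_right adj_adj_dom(2))
  ultimately show ?thesis
    using adj_eqI[OF assms(1)] unfolding adj_dom_def by blast
qed

lemma adj_dom_adj_scaleR:
  assumes "densely_defined \<Omega> D" "w \<in> adj_dom \<Omega> D L"
  shows "r *\<^sub>R w \<in> adj_dom \<Omega> D L \<and> adj \<Omega> D L (r *\<^sub>R w) = r *\<^sub>R adj \<Omega> D L w"
proof -
  have "r *\<^sub>R adj \<Omega> D L w \<in> L2_on \<Omega>" "r *\<^sub>R w \<in> L2_on \<Omega>"
    using assms adj_adj_dom(1)[OF assms(1)]
    by (auto simp: adj_dom_def intro!: subspace_scale[OF subspace_L2_on])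
  moreover have "inner (L u) (r *\<^sub>R w) = inner u (r *\<^sub>R adj \<Omega> D L w)" if "u \<in> D" for u
    using that assms by (simp add: adj_adj_dom(2))
  ultimately show ?thesis
    using adj_eqI[OF assms(1)] unfolding adj_dom_def by blast
qed

section \<open>The weak operator as an isometry onto the dual space\<close>

text \<open>If \<open>W = {0}\<close>, the supremum in \<open>dual_norm\<close> is taken over the empty set and has no
  specified value, hence the last assumption.\<close>

lemma dual_norm_weak_op:
  assumes "T ` W = H" "q \<in> H" "T 0 = 0" "\<exists>z\<in>H. z \<noteq> 0"
  shows "dual_norm W T (weak_op W T q) = norm q"
  unfolding dual_norm_def
proof (rule cSup_eq_maximum)
  \<comment> \<open>Cauchy-Schwarz; if \<open>T w = 0\<close>, the quotient is zero by the
    convention for division.\<close>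
  have le: "\<bar>weak_op W T q w\<bar> / norm (T w) \<le> norm q" if "w \<in> W" for w
    using that Cauchy_Schwarz_ineq2[of q "T w"]
    by (cases "T w = 0") (auto simp: weak_op_def field_simps)
  then show "x \<le> norm q" if "x \<in> (\<lambda>w. \<bar>weak_op W T q w\<bar> / norm (T w)) ` (W - {0})" for x
    using that by auto
  \<comment> \<open>The supremum is attained at a preimage of \<open>q\<close>. For
    \<open>q = 0\<close> every quotient vanishes, and any nonzero \<open>z\<close> supplies an
    admissible \<open>w\<close>.\<close>
  obtain z where z: "z \<in> H" "z \<noteq> 0" "q \<noteq> 0 \<Longrightarrow> z = q" using assms by metis
  then obtain w where w: "w \<in> W" "T w = z" using assms by blast
  have "w \<noteq> 0" using w z assms by auto
  moreover have "\<bar>weak_op W T q w\<bar> / norm (T w) = norm q"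
    using w z by (cases "q = 0") (auto simp: weak_op_def dot_square_norm power2_eq_square)
  ultimately show "norm q \<in> (\<lambda>w. \<bar>weak_op W T q w\<bar> / norm (T w)) ` (W - {0})"
    using w(1) by force
qed

lemma weak_op_in_dual_space:
  assumes "\<And>v w. v \<in> W \<Longrightarrow> w \<in> W \<Longrightarrow> v + w \<in> W \<and> T (v + w) = T v + T w"
    and "\<And>r w. w \<in> W \<Longrightarrow> r *\<^sub>R w \<in> W \<and> T (r *\<^sub>R w) = r *\<^sub>R T w"
  shows "weak_op W T q \<in> dual_space W T"
proof -
  have "\<bar>weak_op W T q w\<bar> \<le> norm q * norm (T w)" if "w \<in> W" for w
    using that Cauchy_Schwarz_ineq2[of q "T w"] by (simp add: weak_op_def)
  moreover have "weak_op W T q \<in> extensional W" by (simp add: weak_op_def)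
  moreover have "weak_op W T q (v + w) = weak_op W T q v + weak_op W T q w"
    if "v \<in> W" "w \<in> W" for v w
    using that assms(1) by (simp add: weak_op_def inner_add_right)
  moreover have "weak_op W T q (r *\<^sub>R w) = r * weak_op W T q w" if "w \<in> W" for r w
    using that assms(2) by (simp add: weak_op_def)
  ultimately show ?thesis unfolding dual_space_def by blast
qed

text \<open>Surjectivity of \<open>T\<close> provides a test element mapped to \<open>p - q\<close>,
  which is thereby orthogonal to itself.\<close>

lemma weak_op_inj_on:
  assumes "T ` W = H" "subspace H"
  shows "inj_on (weak_op W T) H"
proof (rule inj_onI)
  fix p q assume pq: "p \<in> H" "q \<in> H" "weak_op W T p = weak_op W T q"
  obtain w where w: "w \<in> W" "T w = p - q"
    using assms pq subspace_diff by (metis imageE)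
  have "inner p (p - q) = inner q (p - q)"
    using fun_cong[OF pq(3), of w] w by (simp add: weak_op_def)
  then have "inner (p - q) (p - q) = 0" by (simp add: inner_diff_left)
  then show "p = q" by simp
qed

text \<open>Transport \<open>l\<close> along the inverse of \<open>T\<close> to a functional
  \<open>m\<close> on \<open>H\<close>. Boundedness of \<open>l\<close> in the norm of
  \<open>T w\<close> is boundedness of \<open>m\<close> in the norm of \<open>H\<close>, so Riesz
  representation applies.\<close>

lemma dual_space_subset_weak_op:
  assumes range: "T ` W = H" and inj: "inj_on T W" and H: "subspace H" "complete H"
    and add: "\<And>v w. v \<in> W \<Longrightarrow> w \<in> W \<Longrightarrow> v + w \<in> W \<and> T (v + w) = T v + T w"
    and scale: "\<And>r w. w \<in> W \<Longrightarrow> r *\<^sub>R w \<in> W \<and> T (r *\<^sub>R w) = r *\<^sub>R T w"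
  shows "dual_space W T \<subseteq> weak_op W T ` H"
proof
  fix l assume "l \<in> dual_space W T"
  then obtain C where l: "l \<in> extensional W"
      "\<And>v w. v \<in> W \<Longrightarrow> w \<in> W \<Longrightarrow> l (v + w) = l v + l w"
      "\<And>r w. w \<in> W \<Longrightarrow> l (r *\<^sub>R w) = r * l w"
      "\<And>w. w \<in> W \<Longrightarrow> \<bar>l w\<bar> \<le> C * norm (T w)"
    unfolding dual_space_def by blast
  define m where "m z = l (inv_into W T z)" for z
  have m: "m (T w) = l w" if "w \<in> W" for w
    using that inj by (simp add: m_def)
  have "\<exists>q\<in>H. \<forall>x\<in>H. m x = inner q x"
  proof (rule Riesz_representation_complete_subspace[OF H])
    fix x y assume "x \<in> H" "y \<in> H"
    then obtain v w where "v \<in> W" "w \<in> W" "x = T v" "y = T w" using range by blast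
    then show "m (x + y) = m x + m y"
      using add[of v w] l(2)[of v w] m[of v] m[of w] m[of "v + w"] by simp
  next
    fix r x assume "x \<in> H"
    then obtain w where "w \<in> W" "x = T w" using range by blast
    then show "m (r *\<^sub>R x) = r * m x"
      using scale[of w r] l(3)[of w r] m[of w] m[of "r *\<^sub>R w"] by simp
  next
    fix x assume "x \<in> H"
    then obtain w where "w \<in> W" "x = T w" using range by blast
    then show "\<bar>m x\<bar> \<le> C * norm x"
      using l(4) m by simp
  qed
  then obtain q where q: "q \<in> H" "\<And>x. x \<in> H \<Longrightarrow> m x = inner q x" by blast
  have "l = weak_op W T q"
  proof (rule extensionalityI[OF l(1)])
    show "weak_op W T q \<in> extensional W" by (simp add: weak_op_def)
    show "l w = weak_op W T q w" if "w \<in> W" for w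
      using that m[of w] q(2)[of "T w"] range by (auto simp: weak_op_def)
  qed
  with q(1) show "l \<in> weak_op W T ` H" by blast
qed

theorem theorem3p1:
  fixes \<Omega> :: "'a::euclidean_space set"
    and a b :: "'a \<Rightarrow> 'a" and c :: "'a \<Rightarrow> real" and bc :: "'a L2 \<Rightarrow> bool"
    and D :: "'a L2 set" and L :: "'a L2 \<Rightarrow> 'a L2"
    and Dstar :: "'a L2 set" and Lstar :: "'a L2 \<Rightarrow> 'a L2" and cP :: real
  assumes "open \<Omega>" and "connected \<Omega>" and "\<Omega> \<noteq> {}"
    and "first_order_operator \<Omega> a b c bc D L"
    and "linear_operator_in \<Omega> D L" and "densely_defined \<Omega> D" and "closed_operator D L"
    and "Dstar = adj_dom \<Omega> D L" and "Lstar = adj \<Omega> D L"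
    and "cP > 0" and "\<And>w. w \<in> Dstar \<Longrightarrow> cP * norm w \<le> norm (Lstar w)"
    and "Lstar ` Dstar = L2_on \<Omega>"
  shows "bij_betw (weak_op Dstar Lstar) (L2_on \<Omega>) (dual_space Dstar Lstar) \<and>
    (\<forall>p\<in>L2_on \<Omega>. \<forall>q\<in>L2_on \<Omega>.
       dual_norm Dstar Lstar (\<lambda>w\<in>Dstar. weak_op Dstar Lstar p w - weak_op Dstar Lstar q w)
         = norm (p - q)) \<and>
    (\<forall>q\<in>L2_on \<Omega>. norm q = dual_norm Dstar Lstar (weak_op Dstar Lstar q)) \<and>
    (\<forall>u\<in>D. dual_embedding Dstar (L u) \<in> dual_space Dstar Lstar \<and>
       norm u = dual_norm Dstar Lstar (dual_embedding Dstar (L u)))"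
proof -
  note dense = \<open>densely_defined \<Omega> D\<close> and W = \<open>Dstar = adj_dom \<Omega> D L\<close> and T = \<open>Lstar = adj \<Omega> D L\<close>
    and range = \<open>Lstar ` Dstar = L2_on \<Omega>\<close>
  have add: "v + w \<in> Dstar \<and> Lstar (v + w) = Lstar v + Lstar w" if "v \<in> Dstar" "w \<in> Dstar" for v w
    using adj_dom_adj_add[OF dense] that unfolding W T by blast
  have scale: "r *\<^sub>R w \<in> Dstar \<and> Lstar (r *\<^sub>R w) = r *\<^sub>R Lstar w" if "w \<in> Dstar" for r w
    using adj_dom_adj_scaleR[OF dense] that unfolding W T by blast
  \<comment> \<open>The lower bound with positive \<open>cP\<close> leaves only zero in the kernel
    of \<open>Lstar\<close>.\<close>
  have inj: "inj_on Lstar Dstar"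
  proof (rule inj_onI)
    fix v w assume vw: "v \<in> Dstar" "w \<in> Dstar" "Lstar v = Lstar w"
    have "v - w \<in> Dstar \<and> Lstar (v - w) = 0"
      using add[of v "(-1) *\<^sub>R w"] scale[of w "-1"] vw by simp
    then have "cP * norm (v - w) \<le> 0" using assms(11)[of "v - w"] by simp
    then show "v = w" using \<open>cP > 0\<close> by (simp add: mult_le_0_iff)
  qed
  have nontrivial: "\<exists>z\<in>L2_on \<Omega>. z \<noteq> 0"
    using L2_on_nontrivial \<open>open \<Omega>\<close> \<open>\<Omega> \<noteq> {}\<close> .
  \<comment> \<open>Scaling any element of the domain by zero gives
    \<open>Lstar 0 = 0\<close>.\<close>
  then obtain w0 where "w0 \<in> Dstar" using range by blast
  then have zero: "Lstar 0 = 0" using scale[of w0 0] by simp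
  have iso: "dual_norm Dstar Lstar (weak_op Dstar Lstar q) = norm q" if "q \<in> L2_on \<Omega>" for q
    using dual_norm_weak_op[OF range that zero nontrivial] .
  have in_dual: "weak_op Dstar Lstar q \<in> dual_space Dstar Lstar" for q
    using add scale by (rule weak_op_in_dual_space)
  have "weak_op Dstar Lstar ` L2_on \<Omega> = dual_space Dstar Lstar"
    using in_dual dual_space_subset_weak_op[OF range inj subspace_L2_on complete_L2_on add scale]
    by blast
  then have bij: "bij_betw (weak_op Dstar Lstar) (L2_on \<Omega>) (dual_space Dstar Lstar)"
    using weak_op_inj_on[OF range subspace_L2_on] by (simp add: bij_betw_def)
  \<comment> \<open>Linearity in \<open>q\<close> reduces the distance statement to the norm
    identity \<open>iso\<close> at \<open>p - q\<close>.\<close>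
  have diff: "(\<lambda>w\<in>Dstar. weak_op Dstar Lstar p w - weak_op Dstar Lstar q w)
      = weak_op Dstar Lstar (p - q)" for p q
    by (auto simp: weak_op_def inner_diff_left)
  \<comment> \<open>Both functionals are \<open>undefined\<close> off \<open>Dstar\<close>, so the
    adjoint relation on \<open>Dstar\<close> makes them equal; membership in the dual and the norm
    carry over from \<open>weak_op\<close>.\<close>
  have embed: "dual_embedding Dstar (L u) = weak_op Dstar Lstar u" if "u \<in> D" for u
    using adj_adj_dom(2)[OF dense _ that, of _ L]
    by (auto simp: dual_embedding_def weak_op_def W T)
  have "D \<subseteq> L2_on \<Omega>"
    using \<open>linear_operator_in \<Omega> D L\<close> by (simp add: linear_operator_in_def)
  then show ?thesis
    using bij iso in_dual embed subspace_diff[OF subspace_L2_on[of \<Omega>]]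
    by (auto simp: diff subset_iff)
qed

end
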